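(* Let $K\subset\mathbb{R}^n$ be a nonempty closed convex set and let $P:\mathbb{R}^n\to\mathbb{R}^n$ be a polynomial map of degree $d$, where $d$ is a positive integer. If $(K,P)$ is an $R_0$-pair, then the solution map $Q\mapsto\mathrm{SOL}(K,Q)$ on $\mathcal{P}_d$ is locally bounded at $P$, i.e. there exists $\varepsilon>0$ such that the set $$O_\varepsilon:=\bigcup_{Q\in\mathcal{B}(0,\varepsilon)}\mathrm{SOL}(K,P+Q)$$ is bounded, where $\mathcal{B}(0,\varepsilon)$ is the open ball in $\mathcal{P}_d$ with center $0$ and radius $\varepsilon$. Consequently, $\mathrm{SOL}(K,P+Q)$ is bounded for every $Q\in\mathcal{B}(0,\varepsilon)$.
   Context: For a nonempty closed convex set $K\subset\mathbb{R}^n$ and a continuous map $F:\mathbb{R}^n\to\mathbb{R}^n$, $\mathrm{SOL}(K,F)$ denotes the set of $x\in K$ such that $\langle F(x),y-x\rangle\ge 0$ for all $y\in K$. The asymptotic cone of $K$ is $K^\infty=\{v\in\mathbb{R}^n:\exists t_k\to\infty,\ \exists x_k\in K,\ x_k/t_k\to v\}$ (the recession cone of $K$). For a polynomial map $P=(P_1,\dots,P_n)$, its degree is $d=\max_l\deg P_l$, and $P^\infty=(P_1^\infty,\dots,P_n^\infty)$, where $P_l^\infty$ is the homogeneous component of degree $d$ of $P_l$. The pair $(K,P)$ is an $R_0$-pair if $\mathrm{SOL}(K^\infty,P^\infty)=\{0\}$. $\mathcal{P}_d$ is the finite-dimensional vector space of polynomial maps $\mathbb{R}^n\to\mathbb{R}^n$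 all of whose components have degree at most $d$, normed by the Frobenius norm of the matrix of coefficients. *)

theory Defs
  imports "HOL-Analysis.Analysis" "HOL-Library.Poly_Mapping"
begin

text \<open>
  A monomial is its exponent vector, a real polynomial in variables indexed by the finite type
  \<open>'n\<close> is a finitely supported family of coefficients, and a polynomial map is a vector of such
  polynomials. Since the reals are an infinite field, polynomials and polynomial functions
  determine each other, so this is the space of polynomial maps on \<open>real ^ 'n\<close>.
\<close>

type_synonym 'n monomial = "'n \<Rightarrow>\<^sub>0 nat"
type_synonym 'n mpolynomial = "'n monomial \<Rightarrow>\<^sub>0 real"
type_synonym 'n poly_map = "'n mpolynomial ^ 'n"

definition mon_degree :: "'n::finite monomial \<Rightarrow> nat" where
  "mon_degree m = (\<Sum>i\<in>UNIV. Poly_Mapping.lookup m i)"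

definition mpoly_eval :: "'n::finite mpolynomial \<Rightarrow> real ^ 'n \<Rightarrow> real" where
  "mpoly_eval p x = (\<Sum>m\<in>Poly_Mapping.keys p.
     Poly_Mapping.lookup p m * (\<Prod>i\<in>UNIV. (x $ i) ^ Poly_Mapping.lookup m i))"

text \<open>The zero polynomial has degree 0 here.\<close>

definition mpoly_degree :: "'n::finite mpolynomial \<Rightarrow> nat" where
  "mpoly_degree p = Max (insert 0 (mon_degree ` Poly_Mapping.keys p))"

definition hom_component :: "nat \<Rightarrow> 'n::finite mpolynomial \<Rightarrow> 'n mpolynomial" where
  "hom_component k p = (\<Sum>m\<in>{m \<in> Poly_Mapping.keys p. mon_degree m = k}.
     Poly_Mapping.single m (Poly_Mapping.lookup p m))"

definition map_eval :: "'n::finite poly_map \<Rightarrow> real ^ 'n \<Rightarrow> real ^ 'n" where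
  "map_eval P x = (\<chi> l. mpoly_eval (P $ l) x)"

definition map_degree :: "'n::finite poly_map \<Rightarrow> nat" where
  "map_degree P = Max (range (\<lambda>l. mpoly_degree (P $ l)))"

text \<open>Every component is truncated at the degree of the whole map, so components of lower degree
  have leading part 0.\<close>

definition leading_map :: "'n::finite poly_map \<Rightarrow> 'n poly_map" where
  "leading_map P = (\<chi> l. hom_component (map_degree P) (P $ l))"

definition poly_space :: "nat \<Rightarrow> 'n::finite poly_map set" where
  "poly_space d = {Q. \<forall>l. mpoly_degree (Q $ l) \<le> d}"

text \<open>The coefficient matrix has one row per component and one column per monomial; columns
  outside the support of a row contribute 0.\<close>

definition frobenius_norm :: "'n::finite poly_map \<Rightarrow> real" where
  "frobenius_norm Q = sqrt (\<Sum>l\<in>UNIV. \<Sum>m\<in>Poly_Mapping.keys (Q $ l).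
     (Poly_Mapping.lookup (Q $ l) m)\<^sup>2)"

definition poly_ball0 :: "nat \<Rightarrow> real \<Rightarrow> 'n::finite poly_map set" where
  "poly_ball0 d \<epsilon> = {Q \<in> poly_space d. frobenius_norm Q < \<epsilon>}"

definition SOL :: "(real ^ 'n) set \<Rightarrow> (real ^ 'n \<Rightarrow> real ^ 'n) \<Rightarrow> (real ^ 'n) set" where
  "SOL K F = {x \<in> K. \<forall>y\<in>K. F x \<bullet> (y - x) \<ge> 0}"

definition asymptotic_cone :: "(real ^ 'n) set \<Rightarrow> (real ^ 'n) set" where
  "asymptotic_cone K = {v. \<exists>(t :: nat \<Rightarrow> real) x.
     filterlim t at_top sequentially \<and> (\<forall>k. x k \<in> K) \<and> (\<lambda>k. x k /\<^sub>R t k) \<longlonglongrightarrow> v}"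

definition R0_pair :: "(real ^ 'n) set \<Rightarrow> 'n::finite poly_map \<Rightarrow> bool" where
  "R0_pair K P \<longleftrightarrow> SOL (asymptotic_cone K) (map_eval (leading_map P)) = {0}"

end

theory Submission
  imports Defs
begin

text \<open>
  The proof is a blow-up argument. If no \<open>\<epsilon>\<close> works, there are perturbations \<open>Q\<^sub>k\<close> with
  Frobenius norm tending to 0 and solutions \<open>x\<^sub>k\<close> of the problems for \<open>P + Q\<^sub>k\<close> whose norms
  \<open>t\<^sub>k\<close> tend to infinity. By compactness of the unit sphere, along a subsequence \<open>x\<^sub>k / t\<^sub>k\<close>
  converges to a unit vector \<open>v\<close>, which lies in the asymptotic cone of \<open>K\<close>. Dividing by
  \<open>t\<^sub>k ^ d\<close> kills both the perturbation and the lower-order terms, so that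
  \<open>(P + Q\<^sub>k)(x\<^sub>k) / t\<^sub>k ^ d\<close> tends to \<open>P\<^sup>\<infinity>(v)\<close>
  (\<open>scaled_map_eval_tendsto_leading_map\<close>).

  The variational inequality at \<open>x\<^sub>k\<close> is then tested with two kinds of points. A fixed
  \<open>y \<in> K\<close> gives \<open>P\<^sup>\<infinity>(v) \<bullet> (- v) \<ge> 0\<close> after division by \<open>t\<^sub>k ^ (d + 1)\<close>. The points
  \<open>x\<^sub>k + w\<close>, for \<open>w\<close> in the asymptotic cone, belong to \<open>K\<close> as it is closed and convex
  (\<open>asymptotic_cone_translate\<close>) and give \<open>P\<^sup>\<infinity>(v) \<bullet> w \<ge> 0\<close> after division by \<open>t\<^sub>k ^ d\<close>. Adding
  the two shows that the nonzero vector \<open>v\<close> solves the problem for \<open>P\<^sup>\<infinity>\<close> on the asymptotic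
  cone, against the \<open>R\<^sub>0\<close> property.
\<close>

section \<open>Polynomials along sequences tending to infinity\<close>

text \<open>
  Only finitely many monomials occur in polynomials of bounded degree. Limits of such polynomials
  can therefore be taken coefficient by coefficient, over one common index set.
\<close>

lemma finite_monomials_degree_le: "finite {m :: 'n::finite monomial. mon_degree m \<le> d}"
proof -
  let ?A = "{m :: 'n monomial. mon_degree m \<le> d}"
  have "Poly_Mapping.lookup m i \<le> d" if "m \<in> ?A" for m i
  proof -
    have "Poly_Mapping.lookup m i \<le> mon_degree m"
      unfolding mon_degree_def by (rule member_le_sum) auto
    then show ?thesis using that by simp
  qed
  then have "Poly_Mapping.lookup ` ?A \<subseteq> (UNIV \<rightarrow>\<^sub>E {..d})"
    by auto
  then have "finite (Poly_Mapping.lookup ` ?A)"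
    by (rule finite_subset) (auto intro: finite_PiE)
  moreover have "inj_on Poly_Mapping.lookup ?A"
    by (auto intro!: inj_onI intro: poly_mapping_eqI)
  ultimately show ?thesis
    by (rule finite_imageD)
qed

lemma mpoly_eval_sum_superset:
  assumes "finite A" "Poly_Mapping.keys p \<subseteq> A"
  shows "mpoly_eval p x = (\<Sum>m\<in>A. Poly_Mapping.lookup p m *
           (\<Prod>i\<in>UNIV. (x $ i) ^ Poly_Mapping.lookup m i))"
  unfolding mpoly_eval_def
  by (rule sum.mono_neutral_left) (use assms in \<open>auto simp: in_keys_iff\<close>)

lemma mpoly_degree_le_iff:
  "mpoly_degree p \<le> d \<longleftrightarrow> Poly_Mapping.keys p \<subseteq> {m. mon_degree m \<le> d}"
  unfolding mpoly_degree_def by auto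

lemma lookup_hom_component:
  "Poly_Mapping.lookup (hom_component k p) m =
     (if mon_degree m = k then Poly_Mapping.lookup p m else 0)"
proof -
  let ?A = "{m \<in> Poly_Mapping.keys p. mon_degree m = k}"
  have "Poly_Mapping.lookup (hom_component k p) m =
      (\<Sum>m'\<in>?A. if m' = m then Poly_Mapping.lookup p m' else 0)"
    unfolding hom_component_def lookup_sum
    by (rule sum.cong) (simp_all add: lookup_single when_def)
  also have "\<dots> = (if m \<in> ?A then Poly_Mapping.lookup p m else 0)"
    by (rule sum.delta) simp
  finally show ?thesis
    by (simp add: in_keys_iff)
qed

lemma monomial_scaled_eq:
  fixes x :: "real ^ 'n::finite"
  assumes "t \<noteq> 0"
  shows "(\<Prod>i\<in>UNIV. (x $ i) ^ Poly_Mapping.lookup m i) =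
     (\<Prod>i\<in>UNIV. ((x /\<^sub>R t) $ i) ^ Poly_Mapping.lookup m i) * t ^ mon_degree m"
proof -
  have "(\<Prod>i\<in>UNIV. (x $ i) ^ Poly_Mapping.lookup m i) =
      (\<Prod>i\<in>UNIV. ((x /\<^sub>R t) $ i) ^ Poly_Mapping.lookup m i * t ^ Poly_Mapping.lookup m i)"
    by (rule prod.cong) (use assms in \<open>simp_all add: field_simps\<close>)
  then show ?thesis
    by (simp add: prod.distrib mon_degree_def power_sum)
qed

lemma power_ratio_tendsto:
  fixes t :: "nat \<Rightarrow> real"
  assumes t: "filterlim t at_top sequentially" and "j \<le> d"
  shows "(\<lambda>k. t k ^ j / t k ^ d) \<longlonglongrightarrow> (if j = d then 1 else 0)"
proof -
  have pos: "eventually (\<lambda>k. t k > 0) sequentially"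
    using t by (simp add: filterlim_at_top_dense)
  have "(\<lambda>k. inverse (t k) ^ (d - j)) \<longlonglongrightarrow> 0 ^ (d - j)"
    by (intro tendsto_power tendsto_inverse_0_at_top t)
  moreover have "eventually (\<lambda>k. inverse (t k) ^ (d - j) = t k ^ j / t k ^ d) sequentially"
    using pos
  proof eventually_elim
    case (elim k)
    then show ?case
      using \<open>j \<le> d\<close> by (simp add: power_diff field_simps)
  qed
  ultimately have "(\<lambda>k. t k ^ j / t k ^ d) \<longlonglongrightarrow> 0 ^ (d - j)"
    by (rule Lim_transform_eventually)
  then show ?thesis
    using \<open>j \<le> d\<close> by (auto simp: power_0_left split: if_splits)
qed

text \<open>
  A monomial of degree \<open>j\<close> at \<open>x\<^sub>k\<close> equals \<open>t\<^sub>k ^ j\<close> times its value at \<open>x\<^sub>k / t\<^sub>k\<close>. After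
  division by \<open>t\<^sub>k ^ d\<close> only the monomials with \<open>j = d\<close> survive in the limit. The coefficients may
  vary with \<open>k\<close>, which is how the perturbation is absorbed.
\<close>

lemma scaled_mpoly_eval_tendsto_hom_component:
  fixes x :: "nat \<Rightarrow> real ^ 'n::finite" and p :: "nat \<Rightarrow> 'n mpolynomial"
  assumes t: "filterlim t at_top sequentially"
    and v: "(\<lambda>k. x k /\<^sub>R t k) \<longlonglongrightarrow> v"
    and deg: "\<And>k. mpoly_degree (p k) \<le> d"
    and coeff: "\<And>m. (\<lambda>k. Poly_Mapping.lookup (p k) m) \<longlonglongrightarrow> Poly_Mapping.lookup q m"
  shows "(\<lambda>k. mpoly_eval (p k) (x k) / t k ^ d) \<longlonglongrightarrow> mpoly_eval (hom_component d q) v"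
proof -
  let ?A = "{m :: 'n monomial. mon_degree m \<le> d}"
  let ?mon = "\<lambda>m (y :: real ^ 'n). \<Prod>i\<in>UNIV. (y $ i) ^ Poly_Mapping.lookup m i"
  have pos: "eventually (\<lambda>k. t k > 0) sequentially"
    using t by (simp add: filterlim_at_top_dense)
  have "(\<lambda>k. \<Sum>m\<in>?A. Poly_Mapping.lookup (p k) m * ?mon m (x k /\<^sub>R t k) *
            (t k ^ mon_degree m / t k ^ d))
        \<longlonglongrightarrow> (\<Sum>m\<in>?A. Poly_Mapping.lookup q m * ?mon m v * (if mon_degree m = d then 1 else 0))"
    by (intro tendsto_sum tendsto_mult coeff tendsto_prod tendsto_power tendsto_vec_nth v
        power_ratio_tendsto t) simp
  moreover have "eventually (\<lambda>k. (\<Sum>m\<in>?A. Poly_Mapping.lookup (p k) m * ?mon m (x k /\<^sub>R t k) *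
            (t k ^ mon_degree m / t k ^ d)) = mpoly_eval (p k) (x k) / t k ^ d) sequentially"
    using pos
  proof eventually_elim
    case (elim k)
    have "mpoly_eval (p k) (x k) = (\<Sum>m\<in>?A. Poly_Mapping.lookup (p k) m * ?mon m (x k))"
      using deg[of k] by (intro mpoly_eval_sum_superset finite_monomials_degree_le)
        (simp add: mpoly_degree_le_iff)
    also have "\<dots> = (\<Sum>m\<in>?A. Poly_Mapping.lookup (p k) m *
        (?mon m (x k /\<^sub>R t k) * t k ^ mon_degree m))"
      using elim by (intro sum.cong refl arg_cong2[where f="(*)"] monomial_scaled_eq) simp
    finally show ?case
      by (simp only: sum_divide_distrib mult.assoc times_divide_eq_right)
  qed
  ultimately have "(\<lambda>k. mpoly_eval (p k) (x k) / t k ^ d)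
        \<longlonglongrightarrow> (\<Sum>m\<in>?A. Poly_Mapping.lookup q m * ?mon m v * (if mon_degree m = d then 1 else 0))"
    by (rule Lim_transform_eventually)
  also have "(\<Sum>m\<in>?A. Poly_Mapping.lookup q m * ?mon m v * (if mon_degree m = d then 1 else 0))
      = (\<Sum>m\<in>?A. Poly_Mapping.lookup (hom_component d q) m * ?mon m v)"
    by (rule sum.cong) (auto simp: lookup_hom_component)
  also have "\<dots> = mpoly_eval (hom_component d q) v"
    by (rule mpoly_eval_sum_superset[symmetric, OF finite_monomials_degree_le])
      (auto simp: subset_iff in_keys_iff lookup_hom_component split: if_splits)
  finally show ?thesis .
qed

section \<open>Small perturbations of a polynomial map\<close>

lemma frobenius_norm_nonneg: "frobenius_norm Q \<ge> 0"
  unfolding frobenius_norm_def by (simp add: sum_nonneg)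

lemma abs_lookup_le_frobenius_norm:
  "\<bar>Poly_Mapping.lookup (Q $ l) m\<bar> \<le> frobenius_norm Q"
proof (cases "m \<in> Poly_Mapping.keys (Q $ l)")
  case True
  define c where "c l m = (Poly_Mapping.lookup (Q $ l) m)\<^sup>2" for l m
  define row where "row l = (\<Sum>m\<in>Poly_Mapping.keys (Q $ l). c l m)" for l
  have "c l m \<le> row l"
    unfolding row_def by (rule member_le_sum[OF True]) (simp_all add: c_def)
  also have "row l \<le> (\<Sum>l\<in>UNIV. row l)"
    by (rule member_le_sum) (simp_all add: row_def c_def sum_nonneg)
  finally have "sqrt (c l m) \<le> frobenius_norm Q"
    unfolding frobenius_norm_def row_def c_def by (rule real_sqrt_le_mono)
  then show ?thesis
    by (simp add: c_def)
next
  case False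
  then have "Poly_Mapping.lookup (Q $ l) m = 0"
    by (simp only: in_keys_iff not_not)
  then show ?thesis
    by (simp add: frobenius_norm_nonneg)
qed

lemma poly_space_add:
  assumes "P \<in> poly_space d" "Q \<in> poly_space d"
  shows "P + Q \<in> poly_space d"
  using assms Poly_Mapping.keys_add unfolding poly_space_def mpoly_degree_le_iff
  by fastforce

lemma poly_space_map_degree: "P \<in> poly_space (map_degree P)"
  unfolding poly_space_def map_degree_def by simp

lemma scaled_map_eval_tendsto_leading_map:
  fixes x :: "nat \<Rightarrow> real ^ 'n::finite" and Q :: "nat \<Rightarrow> 'n poly_map"
  assumes t: "filterlim t at_top sequentially"
    and v: "(\<lambda>k. x k /\<^sub>R t k) \<longlonglongrightarrow> v"
    and Q: "\<And>k. Q k \<in> poly_space (map_degree P)"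
    and Q0: "(\<lambda>k. frobenius_norm (Q k)) \<longlonglongrightarrow> 0"
  shows "(\<lambda>k. map_eval (P + Q k) (x k) /\<^sub>R t k ^ map_degree P) \<longlonglongrightarrow> map_eval (leading_map P) v"
proof (rule vec_tendstoI)
  fix l
  have coeff: "(\<lambda>k. Poly_Mapping.lookup ((P + Q k) $ l) m) \<longlonglongrightarrow> Poly_Mapping.lookup (P $ l) m"
    for m
  proof -
    have "(\<lambda>k. Poly_Mapping.lookup (Q k $ l) m) \<longlonglongrightarrow> 0"
      by (rule Lim_null_comparison[OF _ Q0]) (simp add: abs_lookup_le_frobenius_norm)
    then have "(\<lambda>k. Poly_Mapping.lookup (P $ l) m + Poly_Mapping.lookup (Q k $ l) m)
        \<longlonglongrightarrow> Poly_Mapping.lookup (P $ l) m + 0"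
      by (intro tendsto_add tendsto_const)
    then show ?thesis
      by (simp add: lookup_add)
  qed
  have "mpoly_degree ((P + Q k) $ l) \<le> map_degree P" for k
    using poly_space_add[OF poly_space_map_degree Q[of k]] by (simp add: poly_space_def)
  from scaled_mpoly_eval_tendsto_hom_component[OF t v this coeff]
  show "(\<lambda>k. (map_eval (P + Q k) (x k) /\<^sub>R t k ^ map_degree P) $ l)
      \<longlonglongrightarrow> map_eval (leading_map P) v $ l"
    by (simp add: map_eval_def leading_map_def field_simps)
qed

section \<open>Variational inequalities and asymptotic cones\<close>

text \<open>
  If \<open>w\<close> is the limit of \<open>x\<^sub>k / t\<^sub>k\<close>, the convex combinations \<open>(1 - 1/t\<^sub>k) y + (1/t\<^sub>k) x\<^sub>k\<close> of
  points of \<open>K\<close> converge to \<open>y + w\<close>.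
\<close>

lemma asymptotic_cone_translate:
  assumes "closed K" "convex K" "y \<in> K" "w \<in> asymptotic_cone K"
  shows "y + w \<in> K"
proof -
  obtain t :: "nat \<Rightarrow> real" and x where t: "filterlim t at_top sequentially"
    and x: "\<And>k. x k \<in> K" and w: "(\<lambda>k. x k /\<^sub>R t k) \<longlonglongrightarrow> w"
    using assms(4) unfolding asymptotic_cone_def by auto
  have "(\<lambda>k. (1 - inverse (t k)) *\<^sub>R y + x k /\<^sub>R t k) \<longlonglongrightarrow> (1 - 0) *\<^sub>R y + w"
    by (intro tendsto_intros w tendsto_inverse_0_at_top t)
  moreover have "eventually (\<lambda>k. t k > 1) sequentially"
    using t by (simp add: filterlim_at_top_dense)
  then have "eventually (\<lambda>k. (1 - inverse (t k)) *\<^sub>R y + x k /\<^sub>R t k \<in> K) sequentially"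
  proof eventually_elim
    case (elim k)
    then show ?case
      using assms(2,3) x[of k] by (intro convexD) (auto simp: inverse_le_1_iff)
  qed
  ultimately have "(1 - 0) *\<^sub>R y + w \<in> K"
    using assms(1) by (intro Lim_in_closed_set) auto
  then show ?thesis by simp
qed

text \<open>
  The limit is tested separately against \<open>w\<close> and \<open>- v\<close>: the points \<open>x\<^sub>k + w\<close> stay in \<open>K\<close> whereas
  \<open>x\<^sub>k + (w - v)\<close> need not.
\<close>

lemma blow_up_limit_in_SOL:
  fixes x :: "nat \<Rightarrow> real ^ 'n::finite" and F :: "nat \<Rightarrow> real ^ 'n \<Rightarrow> real ^ 'n"
  assumes "closed K" "convex K"
    and sol: "\<And>k. x k \<in> SOL K (F k)"
    and t: "filterlim t at_top sequentially"
    and v: "(\<lambda>k. x k /\<^sub>R t k) \<longlonglongrightarrow> v"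
    and F: "(\<lambda>k. F k (x k) /\<^sub>R t k ^ d) \<longlonglongrightarrow> G v"
  shows "v \<in> SOL (asymptotic_cone K) G"
proof -
  have pos: "eventually (\<lambda>k. t k > 0) sequentially"
    using t by (simp add: filterlim_at_top_dense)
  have xK: "x k \<in> K" for k
    using sol by (simp add: SOL_def)
  have ineq: "F k (x k) \<bullet> (y - x k) \<ge> 0" if "y \<in> K" for y k
    using sol[of k] that by (simp add: SOL_def)
  have in_cone: "v \<in> asymptotic_cone K"
    using t v xK unfolding asymptotic_cone_def by blast
  have cone: "G v \<bullet> w \<ge> 0" if w: "w \<in> asymptotic_cone K" for w
  proof (rule tendsto_lowerbound)
    show "(\<lambda>k. (F k (x k) /\<^sub>R t k ^ d) \<bullet> w) \<longlonglongrightarrow> G v \<bullet> w"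
      by (intro tendsto_intros F)
    show "eventually (\<lambda>k. (F k (x k) /\<^sub>R t k ^ d) \<bullet> w \<ge> 0) sequentially"
      using pos
    proof eventually_elim
      case (elim k)
      have "F k (x k) \<bullet> w \<ge> 0"
        using ineq[OF asymptotic_cone_translate[OF assms(1,2) xK w], of k k] by simp
      then show ?case using elim by simp
    qed
  qed simp
  have minus: "G v \<bullet> (- v) \<ge> 0"
  proof (rule tendsto_lowerbound)
    define y where "y = x 0"
    have "(\<lambda>k. (F k (x k) /\<^sub>R t k ^ d) \<bullet> (inverse (t k) *\<^sub>R y - x k /\<^sub>R t k))
        \<longlonglongrightarrow> G v \<bullet> (0 *\<^sub>R y - v)"
      by (intro tendsto_intros F v tendsto_inverse_0_at_top t)
    then show "(\<lambda>k. (F k (x k) /\<^sub>R t k ^ d) \<bullet> (inverse (t k) *\<^sub>R y - x k /\<^sub>R t k))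
        \<longlonglongrightarrow> G v \<bullet> (- v)"
      by simp
    show "eventually (\<lambda>k. (F k (x k) /\<^sub>R t k ^ d) \<bullet> (inverse (t k) *\<^sub>R y - x k /\<^sub>R t k) \<ge> 0)
        sequentially"
      using pos
    proof eventually_elim
      case (elim k)
      have "F k (x k) \<bullet> (y - x k) \<ge> 0"
        using ineq xK by (simp add: y_def)
      then show ?case
        using elim by (simp flip: scaleR_diff_right)
    qed
  qed simp
  have "G v \<bullet> (w - v) \<ge> 0" if "w \<in> asymptotic_cone K" for w
    using cone[OF that] minus by (simp add: inner_diff_right)
  with in_cone show ?thesis
    by (simp add: SOL_def)
qed

section \<open>Local boundedness of the solution map\<close>

theorem theorem3p1:
  fixes K :: "(real ^ 'n::finite) set" and P :: "'n poly_map" and d :: nat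
  assumes "K \<noteq> {}" and "closed K" and "convex K"
    and "d > 0" and "map_degree P = d"
    and "R0_pair K P"
  shows "\<exists>\<epsilon>>0. bounded (\<Union>Q\<in>poly_ball0 d \<epsilon>. SOL K (map_eval (P + Q))) \<and>
           (\<forall>Q\<in>poly_ball0 d \<epsilon>. bounded (SOL K (map_eval (P + Q))))"
proof -
  let ?O = "\<lambda>\<epsilon>. \<Union>Q\<in>poly_ball0 d \<epsilon>. SOL K (map_eval (P + Q))"
  have "\<exists>\<epsilon>>0. bounded (?O \<epsilon>)"
  proof (rule ccontr)
    assume "\<not> (\<exists>\<epsilon>>0. bounded (?O \<epsilon>))"
    then have unbounded: "\<not> bounded (?O \<epsilon>)" if "\<epsilon> > 0" for \<epsilon>
      using that by blast
    have "\<exists>Q x. Q \<in> poly_ball0 d (1 / real (Suc k)) \<and> x \<in> SOL K (map_eval (P + Q)) \<and>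
        norm x > real (Suc k)" for k
    proof -
      have "\<not> bounded (?O (1 / real (Suc k)))"
        by (rule unbounded) simp
      then obtain x where "x \<in> ?O (1 / real (Suc k))" "\<not> norm x \<le> real (Suc k)"
        unfolding bounded_iff by blast
      then show ?thesis
        unfolding not_le by blast
    qed
    then obtain Q x where Q: "\<And>k. Q k \<in> poly_ball0 d (1 / real (Suc k))"
      and x: "\<And>k. x k \<in> SOL K (map_eval (P + Q k))"
      and large: "\<And>k. norm (x k) > real (Suc k)"
      by metis
    have "x k \<noteq> 0" for k
      using large[of k] by auto
    then have "\<forall>k. x k /\<^sub>R norm (x k) \<in> sphere 0 1"
      by simp
    then obtain v r where v: "v \<in> sphere 0 1" and r: "strict_mono r"
      and lim: "((\<lambda>k. x k /\<^sub>R norm (x k)) \<circ> r) \<longlonglongrightarrow> v"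
      using compact_sphere[of "0 :: real ^ 'n" 1, unfolded compact_def, rule_format,
          of "\<lambda>k. x k /\<^sub>R norm (x k)"] by blast
    have "filterlim (\<lambda>k. norm (x k)) at_top sequentially"
    proof (rule filterlim_at_top_mono[OF filterlim_real_sequentially])
      have "real k \<le> norm (x k)" for k
        using large[of k] by simp
      then show "\<forall>\<^sub>F k in sequentially. real k \<le> norm (x k)"
        by simp
    qed
    then have t: "filterlim (\<lambda>k. norm (x (r k))) at_top sequentially"
      by (rule filterlim_compose) (rule filterlim_subseq[OF r])
    have "(\<lambda>k. frobenius_norm (Q k)) \<longlonglongrightarrow> 0"
    proof (rule Lim_null_comparison[OF _ lim_1_over_n[THEN LIMSEQ_Suc]])
      have "norm (frobenius_norm (Q k)) \<le> 1 / of_nat (Suc k)" for k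
        using Q[of k] by (simp add: poly_ball0_def frobenius_norm_nonneg)
      then show "\<forall>\<^sub>F k in sequentially. norm (frobenius_norm (Q k)) \<le> 1 / of_nat (Suc k)"
        by simp
    qed
    then have Q0: "(\<lambda>k. frobenius_norm (Q (r k))) \<longlonglongrightarrow> 0"
      by (rule filterlim_compose) (rule filterlim_subseq[OF r])
    have lim': "(\<lambda>k. x (r k) /\<^sub>R norm (x (r k))) \<longlonglongrightarrow> v"
      using lim by (simp add: o_def)
    have "Q (r k) \<in> poly_space (map_degree P)" for k
      using Q[of "r k"] assms(5) by (simp add: poly_ball0_def)
    from scaled_map_eval_tendsto_leading_map[OF t lim' this Q0]
    have "v \<in> SOL (asymptotic_cone K) (map_eval (leading_map P))"
      by (intro blow_up_limit_in_SOL[OF assms(2,3) x t lim'])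
    then have "v = 0"
      using assms(6) by (simp add: R0_pair_def)
    then show False
      using v by simp
  qed
  then obtain \<epsilon> where "\<epsilon> > 0" and bdd: "bounded (?O \<epsilon>)"
    by blast
  moreover have "bounded (SOL K (map_eval (P + Q)))" if "Q \<in> poly_ball0 d \<epsilon>" for Q
    by (rule bounded_subset[OF bdd]) (use that in blast)
  ultimately show ?thesis
    by blast
qed

end
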